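(* The subroutine which, for given $T,n,w,u,c,K$, computes the weight vector $$\bar w(e)=\begin{cases}u(e), & c(e)\le K,\\ w(e), & c(e)>K,\end{cases}$$ and the corresponding value $\bar w(T)$, and outputs $[\bar w,\bar w(T)]$ as an optimal solution and its optimal value, can solve problem (SDIPT$_{BH}$) in $O(n)$ time.
   Context: Let $T=(V,E)$ be a tree rooted at $s$ with node set $V=\{s,v_1,\dots,v_n\}$ and edge set $E=\{e_1,\dots,e_n\}$, and let $Y=\{t_1,\dots,t_r\}$ be its set of leaf nodes. Each edge $e$ has an original weight $w(e)$, an upper bound $u(e)$ and a cost $c(e)$, with $u(e)\ge w(e)\ge 0$ and $c(e)>0$. For $t_k\in Y$, $P_k$ is the path from $s$ to $t_k$. For an edge weight vector $x$, put $x(P_k)=\sum_{e\in P_k}x(e)$ and $x(T)=\sum_{t_k\in Y}x(P_k)$ (the sum of root-leaf distances). $H(a,b)=0$ if $a=b$ and $H(a,b)=1$ if $a\ne b$. Given a value $K$, problem (SDIPT$_{BH}$) is: maximize $\bar w(T)$ over $\bar w$ subject to $\max_{e\in E}c(e)H(\bar w(e),w(e))\le K$ and $w(e)\le\bar w(e)\le u(e)$ for all $e\in E$.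
   Formalization: Optimality of the output is claimed only for K ≥ 0: for K < 0 problem (SDIPT_BH) has no feasible weight vector, so no optimal solution exists; the computation of the vector and its value in O(n) time is claimed for every K. *)

theory Defs
  imports
    "HOL-Library.Landau_Symbols"
    "Graph_Theory.Digraph_Component"
begin

section \<open>Rooted trees\<close>

text \<open>
  The nodes \<open>s, v\<^sub>1, \<dots>, v\<^sub>n\<close> are the numbers \<open>0, 1, \<dots>, n\<close> (so the root \<open>s\<close> is \<open>0\<close>), and the edges
  \<open>e\<^sub>1, \<dots>, e\<^sub>n\<close> are the numbers \<open>1, \<dots>, n\<close>.  The map \<open>ends\<close> gives the two end nodes of every edge, in
  no particular order: the edges are undirected and carry no information about which end is the
  parent.  An undirected edge \<open>e\<close> is represented by the two arcs \<open>(e, True)\<close> and \<open>(e, False)\<close>.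
\<close>

definition edge_graph :: "nat \<Rightarrow> (nat \<Rightarrow> nat \<times> nat) \<Rightarrow> (nat, nat \<times> bool) pre_digraph" where
  "edge_graph n ends =
    \<lparr> verts = {0..n},
      arcs = {1..n} \<times> UNIV,
      tail = (\<lambda>(e, d). if d then fst (ends e) else snd (ends e)),
      head = (\<lambda>(e, d). if d then snd (ends e) else fst (ends e)) \<rparr>"

text \<open>
  A cycle of the undirected graph is a cycle of \<^const>\<open>edge_graph\<close> that uses no edge twice; this
  excludes going back and forth along one edge, but includes loops and pairs of parallel edges.
\<close>

definition is_tree :: "nat \<Rightarrow> (nat \<Rightarrow> nat \<times> nat) \<Rightarrow> bool" where
  "is_tree n ends \<longleftrightarrow>
    wf_digraph (edge_graph n ends) \<and>
    Digraph_Component.connected (edge_graph n ends) \<and>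
    \<not> (\<exists>p. pre_digraph.cycle (edge_graph n ends) p \<and> distinct (map fst p))"

text \<open>The leaves are the non-root nodes of degree one.\<close>

definition leaves :: "nat \<Rightarrow> (nat \<Rightarrow> nat \<times> nat) \<Rightarrow> nat set" where
  "leaves n ends = {v \<in> {1..n}. out_degree (edge_graph n ends) v = 1}"

text \<open>The edge set of the path from the root to \<open>t\<close>.\<close>

definition root_path :: "nat \<Rightarrow> (nat \<Rightarrow> nat \<times> nat) \<Rightarrow> nat \<Rightarrow> nat set" where
  "root_path n ends t = fst ` set (THE p. pre_digraph.apath (edge_graph n ends) 0 p t)"

definition tree_weight :: "nat \<Rightarrow> (nat \<Rightarrow> nat \<times> nat) \<Rightarrow> (nat \<Rightarrow> real) \<Rightarrow> real" where
  "tree_weight n ends x = (\<Sum>t\<in>leaves n ends. \<Sum>e\<in>root_path n ends t. x e)"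


section \<open>The optimization problem\<close>

definition sdipt_instance ::
  "nat \<Rightarrow> (nat \<Rightarrow> nat \<times> nat) \<Rightarrow> (nat \<Rightarrow> real) \<Rightarrow> (nat \<Rightarrow> real) \<Rightarrow> (nat \<Rightarrow> real) \<Rightarrow> bool" where
  "sdipt_instance n ends w u c \<longleftrightarrow>
    1 \<le> n \<and> is_tree n ends \<and> (\<forall>e\<in>{1..n}. 0 \<le> w e \<and> w e \<le> u e \<and> 0 < c e)"

definition hamming :: "real \<Rightarrow> real \<Rightarrow> real" where
  "hamming a b = (if a = b then 0 else 1)"

definition sdipt_bh_feasible ::
  "nat \<Rightarrow> (nat \<Rightarrow> real) \<Rightarrow> (nat \<Rightarrow> real) \<Rightarrow> (nat \<Rightarrow> real) \<Rightarrow> real \<Rightarrow> (nat \<Rightarrow> real) \<Rightarrow> bool" where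
  "sdipt_bh_feasible n w u c K x \<longleftrightarrow>
    Max ((\<lambda>e. c e * hamming (x e) (w e)) ` {1..n}) \<le> K \<and>
    (\<forall>e\<in>{1..n}. w e \<le> x e \<and> x e \<le> u e)"

definition sdipt_bh_solution ::
  "nat \<Rightarrow> (nat \<Rightarrow> nat \<times> nat) \<Rightarrow> (nat \<Rightarrow> real) \<Rightarrow> (nat \<Rightarrow> real) \<Rightarrow> (nat \<Rightarrow> real) \<Rightarrow> real \<Rightarrow>
    (nat \<Rightarrow> real) \<Rightarrow> real \<Rightarrow> bool" where
  "sdipt_bh_solution n ends w u c K x val \<longleftrightarrow>
    sdipt_bh_feasible n w u c K x \<and> val = tree_weight n ends x \<and>
    (\<forall>y. sdipt_bh_feasible n w u c K y \<longrightarrow> tree_weight n ends y \<le> val)"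

definition upgraded_weight ::
  "(nat \<Rightarrow> real) \<Rightarrow> (nat \<Rightarrow> real) \<Rightarrow> (nat \<Rightarrow> real) \<Rightarrow> real \<Rightarrow> nat \<Rightarrow> real" where
  "upgraded_weight w u c K e = (if c e \<le> K then u e else w e)"


section \<open>The machine model: a real RAM\<close>

text \<open>
  Running time is the number of elementary operations in a while language over arrays of natural
  numbers (addresses, indices, counters) and arrays of real numbers (data).  Arrays are named, and
  a scalar variable is cell \<open>0\<close> of an array.  Every array access, constant, arithmetic operation,
  comparison, Boolean connective, assignment and branch costs one unit.  As usual for a real RAM,
  real arithmetic is exact, and there is no conversion of real numbers to indices.
\<close>

type_synonym arr = string

record ram_state =
  nats :: "arr \<Rightarrow> nat \<Rightarrow> nat"
  reals :: "arr \<Rightarrow> nat \<Rightarrow> real"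

datatype nexp =
    NConst nat
  | NRead arr nexp
  | NAdd nexp nexp
  | NSub nexp nexp

datatype rexp =
    RConst nat
  | RRead arr nexp
  | RAdd rexp rexp
  | RSub rexp rexp
  | RMult rexp rexp

datatype bexp =
    NLe nexp nexp
  | RLe rexp rexp
  | Neg bexp
  | Conj bexp bexp

datatype com =
    Skip
  | NWrite arr nexp nexp
  | RWrite arr nexp rexp
  | Seq com com
  | Cond bexp com com
  | While bexp com

primrec nval :: "nexp \<Rightarrow> ram_state \<Rightarrow> nat" where
  "nval (NConst k) s = k"
| "nval (NRead a i) s = nats s a (nval i s)"
| "nval (NAdd x y) s = nval x s + nval y s"
| "nval (NSub x y) s = nval x s - nval y s"

primrec rval :: "rexp \<Rightarrow> ram_state \<Rightarrow> real" where
  "rval (RConst k) s = real k"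
| "rval (RRead a i) s = reals s a (nval i s)"
| "rval (RAdd x y) s = rval x s + rval y s"
| "rval (RSub x y) s = rval x s - rval y s"
| "rval (RMult x y) s = rval x s * rval y s"

primrec bval :: "bexp \<Rightarrow> ram_state \<Rightarrow> bool" where
  "bval (NLe x y) s \<longleftrightarrow> nval x s \<le> nval y s"
| "bval (RLe x y) s \<longleftrightarrow> rval x s \<le> rval y s"
| "bval (Neg b) s \<longleftrightarrow> \<not> bval b s"
| "bval (Conj b d) s \<longleftrightarrow> bval b s \<and> bval d s"

primrec nops :: "nexp \<Rightarrow> nat" where
  "nops (NConst k) = 1"
| "nops (NRead a i) = 1 + nops i"
| "nops (NAdd x y) = 1 + nops x + nops y"
| "nops (NSub x y) = 1 + nops x + nops y"

primrec rops :: "rexp \<Rightarrow> nat" where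
  "rops (RConst k) = 1"
| "rops (RRead a i) = 1 + nops i"
| "rops (RAdd x y) = 1 + rops x + rops y"
| "rops (RSub x y) = 1 + rops x + rops y"
| "rops (RMult x y) = 1 + rops x + rops y"

primrec bops :: "bexp \<Rightarrow> nat" where
  "bops (NLe x y) = 1 + nops x + nops y"
| "bops (RLe x y) = 1 + rops x + rops y"
| "bops (Neg b) = 1 + bops b"
| "bops (Conj b d) = 1 + bops b + bops d"

definition write_nat :: "arr \<Rightarrow> nat \<Rightarrow> nat \<Rightarrow> ram_state \<Rightarrow> ram_state" where
  "write_nat a i k s = s\<lparr>nats := (nats s)(a := (nats s a)(i := k))\<rparr>"

definition write_real :: "arr \<Rightarrow> nat \<Rightarrow> real \<Rightarrow> ram_state \<Rightarrow> ram_state" where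
  "write_real a i r s = s\<lparr>reals := (reals s)(a := (reals s a)(i := r))\<rparr>"

text \<open>\<open>exec p s t s'\<close>: program \<open>p\<close> started in state \<open>s\<close> halts in state \<open>s'\<close> after \<open>t\<close> operations.\<close>

inductive exec :: "com \<Rightarrow> ram_state \<Rightarrow> nat \<Rightarrow> ram_state \<Rightarrow> bool" where
  Skip: "exec Skip s 1 s"
| NWrite: "exec (NWrite a i x) s (1 + nops i + nops x) (write_nat a (nval i s) (nval x s) s)"
| RWrite: "exec (RWrite a i x) s (1 + nops i + rops x) (write_real a (nval i s) (rval x s) s)"
| Seq: "exec p s t s' \<Longrightarrow> exec q s' t' s'' \<Longrightarrow> exec (Seq p q) s (t + t') s''"
| CondTrue: "bval b s \<Longrightarrow> exec p s t s' \<Longrightarrow> exec (Cond b p q) s (1 + bops b + t) s'"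
| CondFalse: "\<not> bval b s \<Longrightarrow> exec q s t s' \<Longrightarrow> exec (Cond b p q) s (1 + bops b + t) s'"
| WhileFalse: "\<not> bval b s \<Longrightarrow> exec (While b p) s (1 + bops b) s"
| WhileTrue: "bval b s \<Longrightarrow> exec p s t s' \<Longrightarrow> exec (While b p) s' t' s'' \<Longrightarrow>
    exec (While b p) s (1 + bops b + t + t') s''"

text \<open>
  The input is the unordered edge list of the tree, the three data vectors and the bound.  The
  contents of all other memory cells are arbitrary.
\<close>

definition holds_input ::
  "ram_state \<Rightarrow> nat \<Rightarrow> (nat \<Rightarrow> nat \<times> nat) \<Rightarrow> (nat \<Rightarrow> real) \<Rightarrow> (nat \<Rightarrow> real) \<Rightarrow> (nat \<Rightarrow> real) \<Rightarrow>
    real \<Rightarrow> bool" where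
  "holds_input s n ends w u c K \<longleftrightarrow>
    nats s ''n'' 0 = n \<and> reals s ''K'' 0 = K \<and>
    (\<forall>e\<in>{1..n}. nats s ''end1'' e = fst (ends e) \<and> nats s ''end2'' e = snd (ends e) \<and>
      reals s ''w'' e = w e \<and> reals s ''u'' e = u e \<and> reals s ''c'' e = c e)"

definition output_vector :: "ram_state \<Rightarrow> nat \<Rightarrow> real" where
  "output_vector s e = reals s ''wbar'' e"

definition output_value :: "ram_state \<Rightarrow> real" where
  "output_value s = reals s ''value'' 0"

end

theory Submission
  imports Defs
begin

text \<open>
  If \<open>0 \<le> K\<close>, a feasible vector can differ from \<open>w\<close> only on edges of cost at most \<open>K\<close>, so the
  upgraded vector is feasible and pointwise above every feasible vector.

  The value is the sum over all edges \<open>e\<close> of \<open>x e\<close> times the number of leaves below \<open>e\<close>.  These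
  numbers are found in linear time, without adjacency lists, by peeling off non-root nodes of
  degree one: for each node it suffices to maintain its degree and the \<^emph>\<open>sum\<close> of the indices of the
  remaining edges at that node, because at degree one this sum is the index of the only remaining
  edge, and the other end of that edge is its parent.  The scan for nodes of degree one follows a
  peeled node to its parent and otherwise moves to the next index, so every iteration either removes
  an edge or advances the index.
\<close>

section \<open>Parents and leaf counts in the tree\<close>

definition flip :: "'a \<times> bool \<Rightarrow> 'a \<times> bool" where
  "flip a = (fst a, \<not> snd a)"

lemma fst_flip [simp]: "fst (flip a) = fst a"
  by (simp add: flip_def)

lemma fst_eq_iff_flip: "fst a = fst b \<longleftrightarrow> a = b \<or> a = flip b"
  by (cases a; cases b) (auto simp: flip_def)

locale rooted_tree =
  fixes n :: nat and ends :: "nat \<Rightarrow> nat \<times> nat"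
  assumes is_tree: "is_tree n ends"
begin

abbreviation "G \<equiv> edge_graph n ends"

sublocale wf_digraph G
  using is_tree by (simp add: is_tree_def)

lemma verts_G [simp]: "verts G = {0..n}"
  by (simp add: edge_graph_def)

lemma arcs_G: "arcs G = {1..n} \<times> UNIV"
  by (simp add: edge_graph_def)

lemma tail_flip [simp]: "tail G (flip a) = head G a"
  and head_flip [simp]: "head G (flip a) = tail G a"
  by (auto simp: edge_graph_def flip_def split: prod.splits)

lemma flip_in_arcs [simp]: "flip a \<in> arcs G \<longleftrightarrow> a \<in> arcs G"
  by (cases a) (simp add: flip_def arcs_G)

section \<open>Uniqueness of paths in an acyclic graph\<close>

lemma awalk_reverse: "awalk u p v \<Longrightarrow> awalk v (rev (map flip p)) u"
proof (induction p arbitrary: u)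
  case (Cons a p)
  then have "awalk v (rev (map flip p)) (head G a)" "awalk (head G a) [flip a] u"
    using wellformed(1)[of a] by (simp_all add: awalk_Cons_iff awalk_Nil_iff)
  then show ?case
    by (simp add: awalk_appendI del: awalk_append_iff)
qed (simp add: awalk_Nil_iff)

text \<open>If a later arc used the edge of the first arc, the start node would be one of its ends
  and hence be visited a second time.\<close>

lemma apath_distinct_edges: "apath u p v \<Longrightarrow> distinct (map fst p)"
proof (induction p arbitrary: u)
  case (Cons a p)
  have p: "awalk (head G a) p v" and tl: "tail G a \<notin> set (awalk_verts (head G a) p)"
    using Cons.prems unfolding apath_Cons_iff by (auto simp: apath_def)
  have "fst a \<noteq> fst b" if "b \<in> set p" for b
    using awalk_verts_arc1[OF that] awalk_verts_arc2[OF p that] tl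
    by (metis fst_eq_iff_flip tail_flip)
  with Cons show ?case
    by (auto simp: apath_Cons_iff)
qed simp

lemma no_cycle: "cycle p \<Longrightarrow> distinct (map fst p) \<Longrightarrow> False"
  using is_tree by (auto simp: is_tree_def)

text \<open>A walk back from head to tail that avoids the edge of \<open>a\<close> can be shortened
  to a path; together with \<open>a\<close> this path closes up to a cycle without repeated
  edges.\<close>

lemma bridge:
  assumes "a \<in> arcs G" "awalk (head G a) p (tail G a)"
  shows "fst a \<in> fst ` set p"
proof (rule ccontr)
  assume notin: "fst a \<notin> fst ` set p"
  define q where "q = awalk_to_apath p"
  have q: "apath (head G a) q (tail G a)" "set q \<subseteq> set p"
    using assms(2) by (auto simp: q_def apath_awalk_to_apath awalk_to_apath_subset)
  have "cycle (a # q)"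
    using q assms(1) by (auto simp: cycle_def awalk_Cons_iff apath_def)
  moreover have "distinct (map fst (a # q))"
    using apath_distinct_edges[OF q(1)] q(2) notin by auto
  ultimately show False
    by (rule no_cycle)
qed

text \<open>For a loop, the empty walk leads from head to tail and uses no edge, against
  \<open>bridge\<close>.\<close>

lemma no_loop: "a \<in> arcs G \<Longrightarrow> tail G a \<noteq> head G a"
  using bridge[of a "[]"] wellformed[of a] by (force simp: awalk_Nil_iff)

text \<open>Suppose that the paths leave \<open>u\<close> by different arcs \<open>a\<close> and
  \<open>b\<close>. Following \<open>p\<close> to \<open>v\<close> and the other path backwards
  leads from the head of \<open>a\<close> back to its tail, so \<open>bridge\<close> finds the edge
  of \<open>a\<close> on this walk. But \<open>p\<close> does not repeat its first edge, and the
  rest of the other path avoids \<open>u\<close>.\<close>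

lemma apath_unique: "apath u p v \<Longrightarrow> apath u q v \<Longrightarrow> p = q"
proof (induction p arbitrary: u q)
  case Nil
  then show ?case
    using apath_nonempty_ends by (force simp: apath_Nil_iff)
next
  case (Cons a p)
  then obtain b q' where q: "q = b # q'"
    using apath_nonempty_ends[OF Cons.prems(1)] by (cases q) (auto simp: apath_Nil_iff)
  have a: "a \<in> arcs G" "tail G a = u" "apath (head G a) p v"
      "u \<notin> set (awalk_verts (head G a) p)"
    and b: "b \<in> arcs G" "tail G b = u" "apath (head G b) q' v"
      "u \<notin> set (awalk_verts (head G b) q')"
    using Cons.prems unfolding q apath_Cons_iff by auto
  show ?case
  proof (cases "a = b")
    case True
    then show ?thesis
      using Cons.IH a b q by auto
  next
    case False
    have nba: "fst b \<noteq> fst a"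
    proof
      assume "fst b = fst a"
      then have "b = flip a"
        using False by (auto simp: fst_eq_iff_flip)
      then show False
        using a b no_loop[of a] by simp
    qed
    have "fst a \<notin> fst ` set q'"
    proof
      assume "fst a \<in> fst ` set q'"
      then obtain c where c: "c \<in> set q'" "fst a = fst c"
        by auto
      have "tail G c \<in> set (awalk_verts (head G b) q')" "head G c \<in> set (awalk_verts (head G b) q')"
        using awalk_verts_arc1[OF c(1)] awalk_verts_arc2[OF awalkI_apath[OF b(3)] c(1)] by auto
      then show False
        using c(2) a(2) b(4) by (metis fst_eq_iff_flip tail_flip)
    qed
    moreover have "fst a \<notin> fst ` set p"
      using apath_distinct_edges[OF Cons.prems(1)] by simp
    moreover have "awalk (head G a) (p @ rev (map flip (b # q'))) u"
      using a(3) Cons.prems(2) awalk_reverse[of u q v] unfolding q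
      by (intro awalk_appendI[of _ _ v]) (auto simp: apath_def)
    then have "fst a \<in> fst ` set (p @ rev (map flip (b # q')))"
      using a bridge by blast
    moreover have "fst ` set (p @ rev (map flip (b # q'))) = fst ` set p \<union> insert (fst b) (fst ` set q')"
      by (simp add: image_Un image_image)
    ultimately show ?thesis
      using nba by (metis Un_iff insert_iff)
  qed
qed

lemma ex_apath:
  assumes "v \<le> n"
  shows "\<exists>p. apath 0 p v"
proof -
  \<comment> \<open>Connectedness is expressed through the symmetric closure. Since both arcs of
    every edge are present, reachability in \<open>G\<close> itself is the same.\<close>
  have "symmetric G"
    unfolding symmetric_conv by (metis flip_in_arcs tail_flip head_flip)
  moreover have "0 \<rightarrow>\<^sup>*\<^bsub>mk_symmetric G\<^esub> v"
    using is_tree assms by (auto simp: is_tree_def Digraph_Component.connected_def strongly_connected_def)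
  ultimately have "0 \<rightarrow>\<^sup>*\<^bsub>G\<^esub> v"
    by (simp add: reachable_mk_symmetric_eq)
  then show ?thesis
    by (simp add: reachable_apath)
qed

section \<open>Root paths, parents and parent edges\<close>

definition path_to :: "nat \<Rightarrow> (nat \<times> bool) list" where
  "path_to v = (THE p. apath 0 p v)"

lemma path_to_eq: "apath 0 p v \<Longrightarrow> path_to v = p"
  unfolding path_to_def using apath_unique by blast

lemma apath_path_to: "v \<le> n \<Longrightarrow> apath 0 (path_to v) v"
  using ex_apath path_to_eq by metis

lemma root_path_eq: "root_path n ends v = fst ` set (path_to v)"
  by (simp add: root_path_def path_to_def)

text \<open>The edge from \<open>v\<close> towards the root. This is meaningful only for non-root
  nodes, as the root has an empty path and \<open>last []\<close> is unspecified; the same holds for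
  \<open>parent\<close>.\<close>

definition pedge :: "nat \<Rightarrow> nat" where
  "pedge v = fst (last (path_to v))"

definition parent :: "nat \<Rightarrow> nat" where
  "parent v = tail G (last (path_to v))"

text \<open>Cutting off the last arc of a path leaves a path from the root, which by uniqueness is
  the one that \<open>path_to\<close> selects for its end.\<close>

lemma path_to_snoc:
  assumes "apath 0 (p @ [a]) v"
  shows "path_to v = path_to (tail G a) @ [a]" "apath 0 p (tail G a)" "head G a = v" "a \<in> arcs G"
proof -
  have *: "awlast 0 p = tail G a"
    using assms by (auto simp: apath_append_iff apath_Cons_iff)
  then show "apath 0 p (tail G a)" "head G a = v" "a \<in> arcs G"
    using assms by (auto simp: apath_append_iff apath_Cons_iff apath_Nil_iff)
  then show "path_to v = path_to (tail G a) @ [a]"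
    using assms by (simp add: path_to_eq)
qed

lemma path_to_0: "path_to 0 = []"
  by (rule path_to_eq) (simp add: apath_Nil_iff)

lemma path_to_parent:
  assumes "v \<in> {1..n}"
  obtains a where "a \<in> arcs G" "tail G a = parent v" "head G a = v" "fst a = pedge v"
    "path_to v = path_to (parent v) @ [a]"
proof -
  have v: "apath 0 (path_to v) v"
    using assms by (simp add: apath_path_to)
  then have "path_to v \<noteq> []"
    using assms by (auto simp: apath_Nil_iff)
  then obtain p a where pa: "path_to v = p @ [a]"
    by (metis rev_exhaust)
  show ?thesis
    using that[of a] path_to_snoc[of p a v] v pa by (auto simp: parent_def pedge_def)
qed

lemma parent_le: "v \<in> {1..n} \<Longrightarrow> parent v \<le> n"
  by (metis path_to_parent wellformed(1) verts_G atLeastAtMost_iff)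

lemma parent_neq: "v \<in> {1..n} \<Longrightarrow> parent v \<noteq> v"
  by (metis path_to_parent no_loop)

lemma pedge_in: "v \<in> {1..n} \<Longrightarrow> pedge v \<in> {1..n}"
  using path_to_parent[of v] by (metis arcs_G mem_Sigma_iff prod.collapse)

lemma ends_pedge: "v \<in> {1..n} \<Longrightarrow> ends (pedge v) = (v, parent v) \<or> ends (pedge v) = (parent v, v)"
  by (rule path_to_parent[of v]) (auto simp: edge_graph_def prod_eq_iff split: prod.splits if_splits)

lemma length_path_to: "v \<in> {1..n} \<Longrightarrow> length (path_to v) = Suc (length (path_to (parent v)))"
  by (rule path_to_parent[of v]) auto

text \<open>Each step to the parent shortens the root path by one arc.\<close>

lemma depth_induct [consumes 1, case_names root step]:
  assumes "v \<le> n" "P 0" "\<And>v. v \<in> {1..n} \<Longrightarrow> P (parent v) \<Longrightarrow> P v"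
  shows "P v"
  using assms(1)
proof (induction "length (path_to v)" arbitrary: v rule: less_induct)
  case less
  show ?case
  proof (cases "v = 0")
    case False
    then have "v \<in> {1..n}"
      using less.prems by simp
    then show ?thesis
      using less.hyps[of "parent v"] assms(3) parent_le length_path_to by simp
  qed (use assms(2) in simp)
qed

lemma root_path_0: "root_path n ends 0 = {}"
  by (simp add: root_path_eq path_to_0)

lemma root_path_parent:
  assumes "v \<in> {1..n}"
  shows "root_path n ends v = insert (pedge v) (root_path n ends (parent v))"
    and "pedge v \<notin> root_path n ends (parent v)"
proof -
  obtain a where a: "fst a = pedge v" "path_to v = path_to (parent v) @ [a]"
    using path_to_parent[OF assms] by metis
  have "distinct (map fst (path_to v))"
    using assms apath_distinct_edges[OF apath_path_to] by simp
  with a show "root_path n ends v = insert (pedge v) (root_path n ends (parent v))"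
    "pedge v \<notin> root_path n ends (parent v)"
    by (auto simp: root_path_eq)
qed

lemma root_path_subset: "v \<le> n \<Longrightarrow> root_path n ends v \<subseteq> {1..n}"
proof (induction v rule: depth_induct)
  case (step v)
  then show ?case
    using root_path_parent(1)[of v] pedge_in[of v] by auto
qed (simp add: root_path_0)

text \<open>Two nodes sharing a parent edge would be its two ends and so each other's parents, which
  their depths forbid.\<close>

lemma inj_on_pedge: "inj_on pedge {1..n}"
proof (rule inj_onI, rule ccontr)
  fix v w
  assume v: "v \<in> {1..n}" and w: "w \<in> {1..n}" and eq: "pedge v = pedge w" and neq: "v \<noteq> w"
  then have "parent v = w" "parent w = v"
    using ends_pedge[OF v] ends_pedge[OF w] by auto
  then show False
    using length_path_to[OF v] length_path_to[OF w] by simp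
qed

text \<open>There are as many edges as non-root nodes, so injectivity gives surjectivity. Every edge
  is thus named by its lower end.\<close>

lemma pedge_image: "pedge ` {1..n} = {1..n}"
  using inj_on_pedge pedge_in by (intro endo_inj_surj) auto

section \<open>Counting the leaves below a node\<close>

definition below :: "nat \<Rightarrow> real" where
  "below v = (\<Sum>t\<in>leaves n ends. of_bool (pedge v \<in> root_path n ends t))"

lemma leaves_subset: "leaves n ends \<subseteq> {1..n}"
  by (auto simp: leaves_def)

lemma finite_leaves: "finite (leaves n ends)"
  using leaves_subset finite_subset by blast

text \<open>A root path through the parent edge of \<open>v\<close> either ends in \<open>v\<close>
  or continues to exactly one child of \<open>v\<close>. In the induction, passing from
  \<open>parent t\<close> to \<open>t\<close> adds only the edge \<open>pedge t\<close>: it changes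
  the left side for \<open>v = t\<close>, and the sum over the children for
  \<open>v = parent t\<close>.\<close>

lemma pedge_in_root_path:
  assumes "t \<le> n" "v \<in> {1..n}"
  shows "(of_bool (pedge v \<in> root_path n ends t) :: real) =
    of_bool (v = t) + (\<Sum>w | w \<in> {1..n} \<and> parent w = v. of_bool (pedge w \<in> root_path n ends t))"
  using assms(1)
proof (induction t rule: depth_induct)
  case root
  then show ?case
    using assms(2) by (simp add: root_path_0)
next
  case (step t)
  let ?C = "{w. w \<in> {1..n} \<and> parent w = v}"
  have *: "(of_bool (pedge w \<in> root_path n ends t) :: real) =
      of_bool (w = t) + of_bool (pedge w \<in> root_path n ends (parent t))" if "w \<in> {1..n}" for w
    using root_path_parent[OF step(1)] inj_on_pedge that step(1) by (auto dest: inj_onD)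
  have "(\<Sum>w\<in>?C. of_bool (pedge w \<in> root_path n ends t) :: real) =
      (\<Sum>w\<in>?C. of_bool (w = t)) + (\<Sum>w\<in>?C. of_bool (pedge w \<in> root_path n ends (parent t)))"
    unfolding sum.distrib[symmetric] by (intro sum.cong refl *) simp
  also have "(\<Sum>w\<in>?C. of_bool (w = t) :: real) = of_bool (v = parent t)"
    using step(1) by (auto simp: of_bool_def)
  finally show ?case
    using step(2) *[OF assms(2)] by linarith
qed

text \<open>Summing \<open>pedge_in_root_path\<close> over all leaves gives the recursion by which
  peeling accumulates the counts from the bottom up.\<close>

lemma below_children:
  assumes "v \<in> {1..n}"
  shows "below v = of_bool (v \<in> leaves n ends) + (\<Sum>w | w \<in> {1..n} \<and> parent w = v. below w)"
proof -
  have "below v = (\<Sum>t\<in>leaves n ends. of_bool (v = t) +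
      (\<Sum>w | w \<in> {1..n} \<and> parent w = v. of_bool (pedge w \<in> root_path n ends t)))"
    unfolding below_def using leaves_subset assms
    by (intro sum.cong refl pedge_in_root_path) auto
  also have "\<dots> = of_bool (v \<in> leaves n ends) + (\<Sum>w | w \<in> {1..n} \<and> parent w = v. below w)"
    using finite_leaves unfolding sum.distrib below_def
    by (subst sum.swap) (simp add: of_bool_def)
  finally show ?thesis .
qed

text \<open>Double counting: an edge occurs in one root-leaf path for each leaf below it. Through
  \<open>pedge\<close>, the sum over edges becomes a sum over non-root nodes.\<close>

lemma tree_weight_below: "tree_weight n ends x = (\<Sum>v\<in>{1..n}. below v * x (pedge v))"
proof -
  have "(\<Sum>e\<in>root_path n ends t. x e) =
      (\<Sum>v\<in>{1..n}. of_bool (pedge v \<in> root_path n ends t) * x (pedge v))" if "t \<in> leaves n ends" for t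
  proof -
    have "root_path n ends t \<subseteq> {1..n}"
      using that leaves_subset root_path_subset by force
    then have "(\<Sum>e\<in>root_path n ends t. x e) = (\<Sum>e\<in>{1..n}. of_bool (e \<in> root_path n ends t) * x e)"
      by (intro sum.mono_neutral_cong_left) auto
    also have "\<dots> = (\<Sum>v\<in>{1..n}. of_bool (pedge v \<in> root_path n ends t) * x (pedge v))"
      using sum.reindex[OF inj_on_pedge, of "\<lambda>e. of_bool (e \<in> root_path n ends t) * x e"]
      unfolding pedge_image by (simp only: o_def)
    finally show ?thesis .
  qed
  then have "tree_weight n ends x =
      (\<Sum>t\<in>leaves n ends. \<Sum>v\<in>{1..n}. of_bool (pedge v \<in> root_path n ends t) * x (pedge v))"
    by (simp add: tree_weight_def)
  also have "\<dots> = (\<Sum>v\<in>{1..n}. below v * x (pedge v))"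
    by (subst sum.swap) (simp only: below_def sum_distrib_right)
  finally show ?thesis .
qed

lemma tree_weight_mono:
  assumes "\<And>e. e \<in> {1..n} \<Longrightarrow> x e \<le> y e"
  shows "tree_weight n ends x \<le> tree_weight n ends y"
proof -
  have "root_path n ends t \<subseteq> {1..n}" if "t \<in> leaves n ends" for t
    using that leaves_subset root_path_subset by force
  then show ?thesis
    unfolding tree_weight_def using assms by (intro sum_mono) blast
qed

lemma tree_weight_cong:
  assumes "\<And>e. e \<in> {1..n} \<Longrightarrow> x e = y e"
  shows "tree_weight n ends x = tree_weight n ends y"
  using assms by (intro antisym tree_weight_mono) simp_all

text \<open>Sums \<open>f\<close> over the edge ends at \<open>v\<close>. With \<open>f = 1\<close>
  this is the degree in the graph with edge set \<open>A\<close>, with \<open>f = id\<close> the sum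
  of the indices of the incident edges; these are the intended contents of \<open>deg\<close> and
  \<open>esum\<close>.\<close>

definition inc_sum :: "(nat \<Rightarrow> nat) \<Rightarrow> nat set \<Rightarrow> nat \<Rightarrow> nat" where
  "inc_sum f A v = (\<Sum>e\<in>A. (of_bool (v = fst (ends e)) + of_bool (v = snd (ends e))) * f e)"

text \<open>Each edge contributes one arc in either direction, so the out-degree equals the
  undirected degree.\<close>

lemma leaves_iff:
  assumes "v \<in> {1..n}"
  shows "v \<in> leaves n ends \<longleftrightarrow> inc_sum (\<lambda>_. 1) {1..n} v = 1"
proof -
  have "out_degree G v = (\<Sum>a\<in>{1..n} \<times> UNIV. of_bool (tail G a = v))"
    by (simp add: out_degree_def out_arcs_def arcs_G Int_def flip: sum.inter_filter)
  also have "\<dots> = inc_sum (\<lambda>_. 1) {1..n} v"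
    unfolding sum.cartesian_product' inc_sum_def
    by (intro sum.cong refl) (auto simp: UNIV_bool edge_graph_def)
  finally show ?thesis
    using assms by (simp add: leaves_def)
qed

text \<open>Reindexing by lower ends replaces the unordered pair \<open>ends\<close> by a node and
  its parent.\<close>

lemma inc_sum_pedge:
  assumes "S \<subseteq> {1..n}"
  shows "inc_sum f (pedge ` S) v = (\<Sum>w\<in>S. (of_bool (v = w) + of_bool (v = parent w)) * f (pedge w))"
proof -
  have "inc_sum f (pedge ` S) v = (\<Sum>w\<in>S. (of_bool (v = fst (ends (pedge w))) +
      of_bool (v = snd (ends (pedge w)))) * f (pedge w))"
    unfolding inc_sum_def using inj_on_subset[OF inj_on_pedge assms] by (simp add: sum.reindex)
  also have "\<dots> = (\<Sum>w\<in>S. (of_bool (v = w) + of_bool (v = parent w)) * f (pedge w))"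
  proof (intro sum.cong refl)
    fix w
    assume "w \<in> S"
    then have "ends (pedge w) = (w, parent w) \<or> ends (pedge w) = (parent w, w)"
      using assms ends_pedge by blast
    then show "(of_bool (v = fst (ends (pedge w))) + of_bool (v = snd (ends (pedge w)))) * f (pedge w) =
        (of_bool (v = w) + of_bool (v = parent w)) * f (pedge w)"
      by (elim disjE) simp_all
  qed
  finally show ?thesis .
qed

text \<open>A node of maximal depth in \<open>S\<close> works, since its children are deeper. Hence
  a node that can be peeled exists as long as edges remain.\<close>

lemma ex_deepest:
  assumes "S \<subseteq> {1..n}" "S \<noteq> {}"
  obtains v where "v \<in> S" "\<And>w. w \<in> S \<Longrightarrow> parent w \<noteq> v"
proof -
  have "finite S"
    using assms(1) finite_subset by blast
  let ?D = "(\<lambda>v. length (path_to v)) ` S"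
  have "Max ?D \<in> ?D"
    using \<open>finite S\<close> assms(2) by (intro Max_in) auto
  then obtain v where "v \<in> S" and Max: "Max ?D = length (path_to v)"
    by blast
  with \<open>finite S\<close> have v: "v \<in> S" "\<And>w. w \<in> S \<Longrightarrow> length (path_to w) \<le> length (path_to v)"
    by (auto simp flip: Max)
  moreover have "parent w \<noteq> v" if "w \<in> S" for w
    using v(2)[OF that] length_path_to[of w] that assms(1) by auto
  ultimately show ?thesis
    using that by blast
qed

text \<open>The only remaining edge at \<open>v\<close> is its parent edge, so \<open>f = 1\<close>
  gives degree one and \<open>f = id\<close> the index of that edge.\<close>

lemma inc_sum_childless:
  assumes "S \<subseteq> {1..n}" "v \<in> S" "\<And>w. w \<in> S \<Longrightarrow> parent w \<noteq> v"
  shows "inc_sum f (pedge ` S) v = f (pedge v)"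
proof -
  have "finite S"
    using assms(1) finite_subset by blast
  have "inc_sum f (pedge ` S) v = (\<Sum>w\<in>S. if w = v then f (pedge w) else 0)"
    unfolding inc_sum_pedge[OF assms(1)]
  proof (intro sum.cong refl)
    fix w
    assume "w \<in> S"
    then have "v \<noteq> parent w"
      using assms(3) by blast
    then show "(of_bool (v = w) + of_bool (v = parent w)) * f (pedge w) = (if w = v then f (pedge w) else 0)"
      by simp
  qed
  then show ?thesis
    using assms(2) \<open>finite S\<close> by simp
qed

text \<open>Converse of \<open>inc_sum_childless\<close> for the degree. As \<open>S\<close> is
  closed under non-root parents, a non-root node outside \<open>S\<close> has no child in
  \<open>S\<close> and therefore degree zero. A node inside \<open>S\<close> already gets degree one
  from its parent edge, which leaves no room for a child.\<close>

lemma childlessI: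
  assumes "S \<subseteq> {1..n}" "\<And>w. w \<in> S \<Longrightarrow> parent w \<noteq> 0 \<Longrightarrow> parent w \<in> S"
    and "v \<in> {1..n}" "inc_sum (\<lambda>_. 1) (pedge ` S) v = 1"
  shows "v \<in> S" "\<And>w. w \<in> S \<Longrightarrow> parent w \<noteq> v"
proof -
  have fin: "finite S"
    using assms(1) finite_subset by blast
  have sum: "(\<Sum>w\<in>S. of_bool (v = w) + of_bool (v = parent w)) = (1::nat)"
    using assms(4) inc_sum_pedge[OF assms(1), of "\<lambda>_. 1" v] by simp
  show "v \<in> S"
  proof (rule ccontr)
    assume "v \<notin> S"
    then have "v \<noteq> w \<and> v \<noteq> parent w" if "w \<in> S" for w
      using that assms(2)[OF that] assms(3) by auto
    then have "(\<Sum>w\<in>S. of_bool (v = w) + of_bool (v = parent w)) = (0::nat)"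
      by simp
    with sum show False
      by simp
  qed
  moreover have "parent v \<noteq> v"
    using assms(3) by (rule parent_neq)
  ultimately have "(\<Sum>w\<in>S - {v}. of_bool (v = w) + of_bool (v = parent w)) = (0::nat)"
    using sum.remove[OF fin \<open>v \<in> S\<close>, of "\<lambda>w. of_bool (v = w) + of_bool (v = parent w) :: nat"] sum
    by simp
  then have "\<forall>w\<in>S - {v}. parent w \<noteq> v"
    using fin by (subst (asm) sum_eq_0_iff) auto
  then show "parent w \<noteq> v" if "w \<in> S" for w
    using that \<open>parent v \<noteq> v\<close> by (cases "w = v") auto
qed

lemma inc_sum_remove:
  assumes "S \<subseteq> {1..n}" "a \<in> S"
  shows "inc_sum f (pedge ` S) v =
    inc_sum f (pedge ` (S - {a})) v + (of_bool (v = a) + of_bool (v = parent a)) * f (pedge a)"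
proof -
  have "finite S"
    using assms(1) finite_subset by blast
  moreover have "S - {a} \<subseteq> {1..n}"
    using assms(1) by blast
  ultimately show ?thesis
    using assms by (simp only: inc_sum_pedge sum.remove[of S a])
qed

lemma inc_sum_Suc:
  "1 \<le> i \<Longrightarrow> inc_sum f {1..<Suc i} v =
    inc_sum f {1..<i} v + (of_bool (v = fst (ends i)) + of_bool (v = snd (ends i))) * f i"
  by (simp add: inc_sum_def)

lemma inc_sum_empty [simp]: "inc_sum f {} v = 0"
  by (simp add: inc_sum_def)

end


section \<open>Running times of straight-line programs and loops\<close>

primrec straight :: "com \<Rightarrow> bool" where
  "straight Skip \<longleftrightarrow> True"
| "straight (NWrite a i x) \<longleftrightarrow> True"
| "straight (RWrite a i x) \<longleftrightarrow> True"
| "straight (Seq p q) \<longleftrightarrow> straight p \<and> straight q"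
| "straight (Cond b p q) \<longleftrightarrow> straight p \<and> straight q"
| "straight (While b p) \<longleftrightarrow> False"

primrec run :: "com \<Rightarrow> ram_state \<Rightarrow> ram_state" where
  "run Skip s = s"
| "run (NWrite a i x) s = write_nat a (nval i s) (nval x s) s"
| "run (RWrite a i x) s = write_real a (nval i s) (rval x s) s"
| "run (Seq p q) s = run q (run p s)"
| "run (Cond b p q) s = (if bval b s then run p s else run q s)"
| "run (While b p) s = s"

text \<open>A conditional is charged for both branches, which makes the bound independent of the
  state.\<close>

primrec cost :: "com \<Rightarrow> nat" where
  "cost Skip = 1"
| "cost (NWrite a i x) = 1 + nops i + nops x"
| "cost (RWrite a i x) = 1 + nops i + rops x"
| "cost (Seq p q) = cost p + cost q"
| "cost (Cond b p q) = 1 + bops b + cost p + cost q"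
| "cost (While b p) = 0"

lemma exec_straight: "straight p \<Longrightarrow> \<exists>t\<le>cost p. exec p s t (run p s)"
proof (induction p arbitrary: s)
  case Skip
  show ?case
    using exec.Skip[of s] by auto
next
  case (NWrite a i x)
  show ?case
    using exec.NWrite[of a i x s] by auto
next
  case (RWrite a i x)
  show ?case
    using exec.RWrite[of a i x s] by auto
next
  case (Seq p q)
  then obtain t t' where "t \<le> cost p" "exec p s t (run p s)"
      "t' \<le> cost q" "exec q (run p s) t' (run q (run p s))"
    by fastforce
  then show ?case
    by (auto intro!: exI[of _ "t + t'"] exec.Seq)
next
  case (Cond b p q)
  then obtain t t' where "t \<le> cost p" "exec p s t (run p s)" "t' \<le> cost q" "exec q s t' (run q s)"
    by fastforce
  then show ?case
    using exec.CondTrue[of b s p t "run p s" q] exec.CondFalse[of b s q t' "run q s" p]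
    by (cases "bval b s") (force intro: exI[of _ "1 + bops b + t"] exI[of _ "1 + bops b + t'"])+
qed simp

definition halts :: "com \<Rightarrow> ram_state \<Rightarrow> nat \<Rightarrow> (ram_state \<Rightarrow> bool) \<Rightarrow> bool" where
  "halts p s T Q \<longleftrightarrow> (\<exists>t s'. exec p s t s' \<and> t \<le> T \<and> Q s')"

lemma halts_straight: "straight p \<Longrightarrow> Q (run p s) \<Longrightarrow> halts p s (cost p) Q"
  using exec_straight[of p s] by (auto simp: halts_def)

lemma halts_Seq:
  assumes "halts p s T P" "\<And>s'. P s' \<Longrightarrow> halts q s' T' Q"
  shows "halts (Seq p q) s (T + T') Q"
proof -
  obtain t s' where s': "exec p s t s'" "t \<le> T" "P s'"
    using assms(1) by (auto simp: halts_def)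
  then obtain t' s'' where "exec q s' t' s''" "t' \<le> T'" "Q s''"
    using assms(2) unfolding halts_def by blast
  with s' show ?thesis
    unfolding halts_def using exec.Seq add_mono by blast
qed

definition iter_cost :: "bexp \<Rightarrow> com \<Rightarrow> nat" where
  "iter_cost b p = 1 + bops b + cost p"

text \<open>The measure bounds the number of iterations, each of which costs at most
  \<open>iter_cost b p\<close>. The \<open>Suc\<close> pays for the final failing test.\<close>

lemma halts_While:
  assumes "straight p" "I s"
    and "\<And>s. I s \<Longrightarrow> bval b s \<Longrightarrow> I (run p s) \<and> m (run p s) < m s"
    and "\<And>s. I s \<Longrightarrow> \<not> bval b s \<Longrightarrow> Q s"
  shows "halts (While b p) s (Suc (m s) * iter_cost b p) Q"
  using assms(2)
proof (induction "m s" arbitrary: s rule: less_induct)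
  case less
  show ?case
  proof (cases "bval b s")
    case True
    obtain t where t: "t \<le> cost p" "exec p s t (run p s)"
      using exec_straight[OF assms(1)] by blast
    have m: "m (run p s) < m s" and "I (run p s)"
      using assms(3) less.prems True by auto
    then obtain t' s' where s': "exec (While b p) (run p s) t' s'"
        "t' \<le> Suc (m (run p s)) * iter_cost b p" "Q s'"
      using less.hyps unfolding halts_def by blast
    have "t' \<le> m s * iter_cost b p"
      using s'(2) m by (meson Suc_leI mult_le_mono1 order_trans)
    then have "1 + bops b + t + t' \<le> iter_cost b p + m s * iter_cost b p"
      using t(1) by (simp add: iter_cost_def)
    then show ?thesis
      using exec.WhileTrue[OF True t(2) s'(1)] s'(3) unfolding halts_def by (metis mult_Suc)
  next
    case False
    then show ?thesis
      unfolding halts_def using exec.WhileFalse[OF False, of p] assms(4) less.prems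
      by (intro exI[of _ "1 + bops b"] exI[of _ s]) (simp add: iter_cost_def)
  qed
qed

section \<open>State updates and derived commands\<close>

lemma write_nat_simps [simp]:
  "nats (write_nat a i k s) b j = (if b = a \<and> j = i then k else nats s b j)"
  "reals (write_nat a i k s) = reals s"
  by (simp_all add: write_nat_def)

lemma write_real_simps [simp]:
  "reals (write_real a i r s) b j = (if b = a \<and> j = i then r else reals s b j)"
  "nats (write_real a i r s) = nats s"
  by (simp_all add: write_real_def)

abbreviation nvar :: "arr \<Rightarrow> nexp" where
  "nvar x \<equiv> NRead x (NConst 0)"

definition nset :: "arr \<Rightarrow> nexp \<Rightarrow> com" where
  "nset x k = NWrite x (NConst 0) k"

definition add_at :: "arr \<Rightarrow> nexp \<Rightarrow> nexp \<Rightarrow> com" where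
  "add_at a i k = NWrite a i (NAdd (NRead a i) k)"

definition sub_at :: "arr \<Rightarrow> nexp \<Rightarrow> nexp \<Rightarrow> com" where
  "sub_at a i k = NWrite a i (NSub (NRead a i) k)"

lemma straight_updates [simp]: "straight (nset x k)" "straight (add_at a i k)" "straight (sub_at a i k)"
  by (simp_all add: nset_def add_at_def sub_at_def)

text \<open>Increments are written with \<open>of_bool\<close>, the shape of the terms in
  \<open>inc_sum_Suc\<close> and \<open>inc_sum_remove\<close>, so that program steps and incidence
  sums can be matched directly.\<close>

lemma run_updates [simp]:
  "nats (run (nset x k) s) b j = (if b = x \<and> j = 0 then nval k s else nats s b j)"
  "nats (run (add_at a i k) s) b j =
    (if b = a then nats s b j + of_bool (j = nval i s) * nval k s else nats s b j)"
  "nats (run (sub_at a i k) s) b j =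
    (if b = a then nats s b j - of_bool (j = nval i s) * nval k s else nats s b j)"
  "reals (run (nset x k) s) = reals s"
  "reals (run (add_at a i k) s) = reals s"
  "reals (run (sub_at a i k) s) = reals s"
  by (simp_all add: nset_def add_at_def sub_at_def)

primrec block :: "com list \<Rightarrow> com" where
  "block [] = Skip"
| "block (p # ps) = Seq p (block ps)"


section \<open>The peeling algorithm\<close>

definition init_body :: com where
  "init_body = block
    [NWrite ''deg'' (nvar ''i'') (NConst 0),
     NWrite ''esum'' (nvar ''i'') (NConst 0),
     add_at ''i'' (NConst 0) (NConst 1)]"

definition edge_body :: com where
  "edge_body = block
    [Cond (RLe (RRead ''c'' (nvar ''i'')) (RRead ''K'' (NConst 0)))
       (RWrite ''wbar'' (nvar ''i'') (RRead ''u'' (nvar ''i'')))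
       (RWrite ''wbar'' (nvar ''i'') (RRead ''w'' (nvar ''i''))),
     add_at ''deg'' (NRead ''end1'' (nvar ''i'')) (NConst 1),
     add_at ''deg'' (NRead ''end2'' (nvar ''i'')) (NConst 1),
     add_at ''esum'' (NRead ''end1'' (nvar ''i'')) (nvar ''i''),
     add_at ''esum'' (NRead ''end2'' (nvar ''i'')) (nvar ''i''),
     add_at ''i'' (NConst 0) (NConst 1)]"

definition deg_one :: "nexp \<Rightarrow> bexp" where
  "deg_one x = Conj (NLe (NRead ''deg'' x) (NConst 1)) (NLe (NConst 1) (NRead ''deg'' x))"

definition leaf_body :: com where
  "leaf_body = block
    [Cond (deg_one (nvar ''i''))
       (RWrite ''cnt'' (nvar ''i'') (RConst 1))
       (RWrite ''cnt'' (nvar ''i'') (RConst 0)),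
     add_at ''i'' (NConst 0) (NConst 1)]"

text \<open>The sum of both ends minus the current node is the other end, whatever the order of the
  ends. \<open>cnt\<close> is a real array because its entries are multiplied with weights and
  expressions offer no conversion from naturals to reals.\<close>

definition peel :: com where
  "peel = block
    [nset ''e'' (NRead ''esum'' (nvar ''cur'')),
     nset ''p'' (NSub (NAdd (NRead ''end1'' (nvar ''e'')) (NRead ''end2'' (nvar ''e''))) (nvar ''cur'')),
     sub_at ''deg'' (nvar ''cur'') (NConst 1),
     sub_at ''deg'' (nvar ''p'') (NConst 1),
     sub_at ''esum'' (nvar ''cur'') (nvar ''e''),
     sub_at ''esum'' (nvar ''p'') (nvar ''e''),
     RWrite ''cnt'' (nvar ''p'') (RAdd (RRead ''cnt'' (nvar ''p'')) (RRead ''cnt'' (nvar ''cur''))),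
     RWrite ''value'' (NConst 0) (RAdd (RRead ''value'' (NConst 0))
       (RMult (RRead ''cnt'' (nvar ''cur'')) (RRead ''wbar'' (nvar ''e'')))),
     nset ''cur'' (nvar ''p''),
     sub_at ''m'' (NConst 0) (NConst 1)]"

definition next_start :: com where
  "next_start = block
    [nset ''cur'' (nvar ''v''),
     add_at ''v'' (NConst 0) (NConst 1)]"

text \<open>The test \<open>1 <= cur\<close> protects the root, which can also reach degree one. It
  also makes the initial value \<open>cur = 0\<close> fetch the first start node.\<close>

definition peel_body :: com where
  "peel_body = Cond (Conj (NLe (NConst 1) (nvar ''cur'')) (deg_one (nvar ''cur''))) peel next_start"

definition index_le_n :: bexp where
  "index_le_n = NLe (nvar ''i'') (nvar ''n'')"

definition edges_left :: bexp where
  "edges_left = NLe (NConst 1) (nvar ''m'')"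

definition init_phase :: com where
  "init_phase = Seq (nset ''i'' (NConst 0)) (While index_le_n init_body)"

definition edge_phase :: com where
  "edge_phase = Seq (nset ''i'' (NConst 1)) (While index_le_n edge_body)"

definition leaf_phase :: com where
  "leaf_phase = Seq (nset ''i'' (NConst 1)) (While index_le_n leaf_body)"

definition start_peel :: com where
  "start_peel = block
    [RWrite ''value'' (NConst 0) (RConst 0),
     nset ''cur'' (NConst 0),
     nset ''v'' (NConst 1),
     nset ''m'' (nvar ''n'')]"

definition peel_phase :: com where
  "peel_phase = Seq start_peel (While edges_left peel_body)"

definition subroutine :: com where
  "subroutine = Seq init_phase (Seq edge_phase (Seq leaf_phase peel_phase))"

text \<open>The factors count the iterations and the final test: the clearing loop runs over
  \<open>0..n\<close>, the edge and leaf loops over \<open>1..n\<close>, and the peeling loop makes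
  at most \<open>n\<close> removals and \<open>n\<close> advances.\<close>

definition init_time :: "nat \<Rightarrow> nat" where
  "init_time n = cost (nset ''i'' (NConst 0)) + (n + 2) * iter_cost index_le_n init_body"

definition edge_time :: "nat \<Rightarrow> nat" where
  "edge_time n = cost (nset ''i'' (NConst 1)) + (n + 1) * iter_cost index_le_n edge_body"

definition leaf_time :: "nat \<Rightarrow> nat" where
  "leaf_time n = cost (nset ''i'' (NConst 1)) + (n + 1) * iter_cost index_le_n leaf_body"

definition peel_time :: "nat \<Rightarrow> nat" where
  "peel_time n = cost start_peel + (2 * n + 1) * iter_cost edges_left peel_body"

definition time :: "nat \<Rightarrow> nat" where
  "time n = init_time n + (edge_time n + (leaf_time n + peel_time n))"

lemma affine_bigo: "(\<lambda>n. real (a + n * b)) \<in> O(\<lambda>n. real n)"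
proof (rule bigoI)
  have "real (a + n * b) \<le> real (a + b) * real n" if "1 \<le> n" for n
  proof -
    have "a + n * b \<le> (a + b) * n"
      using that by (simp add: algebra_simps)
    then show ?thesis
      by (metis of_nat_le_iff of_nat_mult)
  qed
  then show "\<forall>\<^sub>F n in at_top. norm (real (a + n * b)) \<le> real (a + b) * norm (real n)"
    by (auto simp: eventually_at_top_linorder intro!: exI[of _ 1])
qed

lemma time_bigo: "(\<lambda>n. real (time n)) \<in> O(\<lambda>n. real n)"
proof -
  let ?I = "iter_cost index_le_n init_body" and ?E = "iter_cost index_le_n edge_body"
    and ?L = "iter_cost index_le_n leaf_body" and ?P = "iter_cost edges_left peel_body"
  have "time n = (init_time 0 + edge_time 0 + leaf_time 0 + peel_time 0) + n * (?I + ?E + ?L + 2 * ?P)" for n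
    by (simp add: time_def init_time_def edge_time_def leaf_time_def peel_time_def algebra_simps)
  then show ?thesis
    using affine_bigo by (simp only:)
qed

lemma straight_parts [simp]:
  "straight init_body" "straight edge_body" "straight leaf_body" "straight start_peel" "straight peel_body"
  by (simp_all add: init_body_def edge_body_def leaf_body_def start_peel_def peel_body_def
      peel_def next_start_def)

lemma bval_deg_one [simp]: "bval (deg_one x) s \<longleftrightarrow> nats s ''deg'' (nval x s) = 1"
  by (auto simp: deg_one_def)

lemma bval_guards [simp]:
  "bval index_le_n s \<longleftrightarrow> nats s ''i'' 0 \<le> nats s ''n'' 0"
  "bval edges_left s \<longleftrightarrow> 1 \<le> nats s ''m'' 0"
  by (simp_all add: index_le_n_def edges_left_def)


section \<open>Correctness\<close>

locale sdipt_tree = rooted_tree +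
  fixes w u c :: "nat \<Rightarrow> real" and K :: real
begin

abbreviation input :: "ram_state \<Rightarrow> bool" where
  "input s \<equiv> holds_input s n ends w u c K"

abbreviation upgraded :: "nat \<Rightarrow> real" where
  "upgraded \<equiv> upgraded_weight w u c K"

definition init_inv :: "ram_state \<Rightarrow> bool" where
  "init_inv s \<longleftrightarrow> input s \<and> (\<forall>v<nats s ''i'' 0. nats s ''deg'' v = 0 \<and> nats s ''esum'' v = 0)"

text \<open>The bound \<open>i\<close> is a parameter rather than the content of the counter cell,
  because the leaf phase reuses that cell while all edges stay entered.\<close>

definition edges_inv :: "ram_state \<Rightarrow> nat \<Rightarrow> bool" where
  "edges_inv s i \<longleftrightarrow> input s \<and>
    (\<forall>v\<le>n. nats s ''deg'' v = inc_sum (\<lambda>_. 1) {1..<i} v \<and> nats s ''esum'' v = inc_sum id {1..<i} v) \<and>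
    (\<forall>e\<in>{1..<i}. reals s ''wbar'' e = upgraded e)"

definition edge_inv :: "ram_state \<Rightarrow> bool" where
  "edge_inv s \<longleftrightarrow> nats s ''i'' 0 \<in> {1..Suc n} \<and> edges_inv s (nats s ''i'' 0)"

definition leaf_inv :: "ram_state \<Rightarrow> bool" where
  "leaf_inv s \<longleftrightarrow> nats s ''i'' 0 \<in> {1..Suc n} \<and> edges_inv s (Suc n) \<and>
    (\<forall>v\<in>{1..<nats s ''i'' 0}. reals s ''cnt'' v = of_bool (v \<in> leaves n ends))"

text \<open>
  \<open>S\<close> is the set of the nodes whose edge to their parent has not been peeled off.  Cell \<open>0\<close> of
  \<open>cnt\<close> is never initialized: the root is not peeled, so that cell does not affect the output.
\<close>

definition peel_inv :: "nat set \<Rightarrow> ram_state \<Rightarrow> bool" where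
  "peel_inv S s \<longleftrightarrow> input s \<and>
    S \<subseteq> {1..n} \<and> (\<forall>v\<in>S. parent v \<noteq> 0 \<longrightarrow> parent v \<in> S) \<and> nats s ''m'' 0 = card S \<and>
    (\<forall>v\<le>n. nats s ''deg'' v = inc_sum (\<lambda>_. 1) (pedge ` S) v) \<and>
    (\<forall>v\<le>n. nats s ''esum'' v = inc_sum id (pedge ` S) v) \<and>
    (\<forall>e\<in>{1..n}. reals s ''wbar'' e = upgraded e) \<and>
    (\<forall>v\<in>{1..n}. reals s ''cnt'' v + (\<Sum>z | z \<in> S \<and> parent z = v. below z) = below v) \<and>
    reals s ''value'' 0 + (\<Sum>v\<in>S. below v * upgraded (pedge v)) = tree_weight n ends upgraded \<and>
    nats s ''cur'' 0 \<le> n \<and> nats s ''v'' 0 \<in> {1..Suc n} \<and>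
    (\<forall>v\<in>{1..<nats s ''v'' 0}. v \<noteq> nats s ''cur'' 0 \<longrightarrow> nats s ''deg'' v \<noteq> 1)"

text \<open>Before the first edge is entered all incidence sums are empty, so clearing the cells
  \<open>0..n\<close> establishes \<open>edges_inv\<close> at index 1.\<close>

lemma halts_init_phase:
  assumes "input s"
  shows "halts init_phase s (init_time n) (\<lambda>s. edges_inv s 1)"
  unfolding init_phase_def init_time_def
proof (rule halts_Seq)
  show "halts (nset ''i'' (NConst 0)) s (cost (nset ''i'' (NConst 0))) (\<lambda>s. init_inv s \<and> nats s ''i'' 0 = 0)"
    using assms by (intro halts_straight) (auto simp: init_inv_def holds_input_def)
next
  fix s
  assume s: "init_inv s \<and> nats s ''i'' 0 = 0"
  let ?m = "\<lambda>s. Suc n - nats s ''i'' 0"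
  have "halts (While index_le_n init_body) s
    (Suc (?m s) * iter_cost index_le_n init_body) (\<lambda>s. edges_inv s 1)"
  proof (rule halts_While)
    show "init_inv s"
      using s by simp
    show "init_inv (run init_body s) \<and> ?m (run init_body s) < ?m s"
      if "init_inv s" "bval index_le_n s" for s
      using that by (auto simp: init_inv_def init_body_def holds_input_def less_Suc_eq)
    show "edges_inv s 1" if "init_inv s" "\<not> bval index_le_n s" for s
      using that by (auto simp: init_inv_def edges_inv_def holds_input_def)
  qed simp
  then show "halts (While index_le_n init_body) s
    ((n + 2) * iter_cost index_le_n init_body) (\<lambda>s. edges_inv s 1)"
    using s by simp
qed

lemma halts_edge_phase:
  assumes "edges_inv s 1"
  shows "halts edge_phase s (edge_time n) (\<lambda>s. edges_inv s (Suc n))"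
  unfolding edge_phase_def edge_time_def
proof (rule halts_Seq)
  show "halts (nset ''i'' (NConst 1)) s (cost (nset ''i'' (NConst 1))) (\<lambda>s. edge_inv s \<and> nats s ''i'' 0 = 1)"
    using assms by (intro halts_straight) (auto simp: edge_inv_def edges_inv_def holds_input_def)
next
  fix s
  assume s: "edge_inv s \<and> nats s ''i'' 0 = 1"
  let ?m = "\<lambda>s. Suc n - nats s ''i'' 0"
  have "halts (While index_le_n edge_body) s
    (Suc (?m s) * iter_cost index_le_n edge_body) (\<lambda>s. edges_inv s (Suc n))"
  proof (rule halts_While)
    show "edge_inv s"
      using s by simp
    show "edge_inv (run edge_body s) \<and> ?m (run edge_body s) < ?m s"
      if inv: "edge_inv s" and guard: "bval index_le_n s" for s
    proof -
      define i where "i = nats s ''i'' 0"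
      have i: "nats s ''i'' 0 = i" "1 \<le> i" "i \<le> n" and e: "edges_inv s i"
        using inv guard by (auto simp: edge_inv_def edges_inv_def holds_input_def i_def)
      have in_s: "input s"
        using e by (simp add: edges_inv_def)
      have i': "nats (run edge_body s) ''i'' 0 = Suc i"
        using i by (simp add: edge_body_def)
      moreover have "edges_inv (run edge_body s) (Suc i)"
        unfolding edges_inv_def
      proof (intro conjI allI impI ballI)
        show "input (run edge_body s)"
          using in_s by (simp add: holds_input_def edge_body_def)
        fix v
        assume "v \<le> n"
        then show "nats (run edge_body s) ''deg'' v = inc_sum (\<lambda>_. 1) {1..<Suc i} v"
          "nats (run edge_body s) ''esum'' v = inc_sum id {1..<Suc i} v"
          using e i in_s unfolding edges_inv_def inc_sum_Suc[OF i(2)] holds_input_def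
          by (simp_all add: edge_body_def)
      next
        fix e'
        assume "e' \<in> {1..<Suc i}"
        then show "reals (run edge_body s) ''wbar'' e' = upgraded e'"
          using e i in_s unfolding edges_inv_def holds_input_def
          by (auto simp: edge_body_def upgraded_weight_def less_Suc_eq)
      qed
      ultimately show ?thesis
        using i by (simp add: edge_inv_def)
    qed
    show "edges_inv s (Suc n)" if "edge_inv s" "\<not> bval index_le_n s" for s
    proof -
      have "nats s ''i'' 0 = Suc n"
        using that by (auto simp: edge_inv_def edges_inv_def holds_input_def)
      then show ?thesis
        using that by (simp add: edge_inv_def)
    qed
  qed simp
  then show "halts (While index_le_n edge_body) s
    ((n + 1) * iter_cost index_le_n edge_body) (\<lambda>s. edges_inv s (Suc n))"
    using s by simp
qed

text \<open>Leaves are recorded in a pass of their own, while \<open>deg\<close> still holds the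
  degrees in the whole tree; during peeling inner nodes reach degree one as well.\<close>

lemma halts_leaf_phase:
  assumes "edges_inv s (Suc n)"
  shows "halts leaf_phase s (leaf_time n)
    (\<lambda>s. leaf_inv s \<and> nats s ''i'' 0 = Suc n)"
  unfolding leaf_phase_def leaf_time_def
proof (rule halts_Seq)
  show "halts (nset ''i'' (NConst 1)) s (cost (nset ''i'' (NConst 1))) (\<lambda>s. leaf_inv s \<and> nats s ''i'' 0 = 1)"
    using assms by (intro halts_straight) (auto simp: leaf_inv_def edges_inv_def holds_input_def)
next
  fix s
  assume s: "leaf_inv s \<and> nats s ''i'' 0 = 1"
  let ?m = "\<lambda>s. Suc n - nats s ''i'' 0"
  have "halts (While index_le_n leaf_body) s
    (Suc (?m s) * iter_cost index_le_n leaf_body)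
    (\<lambda>s. leaf_inv s \<and> nats s ''i'' 0 = Suc n)"
  proof (rule halts_While)
    show "leaf_inv s"
      using s by simp
    show "leaf_inv (run leaf_body s) \<and> ?m (run leaf_body s) < ?m s"
      if inv: "leaf_inv s" and guard: "bval index_le_n s" for s
    proof -
      define i where "i = nats s ''i'' 0"
      have i: "nats s ''i'' 0 = i" "i \<in> {1..n}" and e: "edges_inv s (Suc n)"
        using inv guard by (auto simp: leaf_inv_def edges_inv_def holds_input_def i_def)
      have "edges_inv (run leaf_body s) (Suc n)"
        using e by (simp add: edges_inv_def holds_input_def leaf_body_def)
      moreover have "nats s ''deg'' i = 1 \<longleftrightarrow> i \<in> leaves n ends"
        using e i leaves_iff[of i] by (simp add: edges_inv_def atLeastLessThanSuc_atLeastAtMost)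
      then have "reals (run leaf_body s) ''cnt'' v = of_bool (v \<in> leaves n ends)" if "v \<in> {1..<Suc i}" for v
        using inv i that by (auto simp: leaf_inv_def leaf_body_def less_Suc_eq)
      moreover have "nats (run leaf_body s) ''i'' 0 = Suc i"
        using i by (simp add: leaf_body_def)
      ultimately show ?thesis
        using i by (simp add: leaf_inv_def Suc_diff_le)
    qed
    show "leaf_inv s \<and> nats s ''i'' 0 = Suc n"
      if "leaf_inv s" "\<not> bval index_le_n s" for s
      using that by (auto simp: leaf_inv_def edges_inv_def holds_input_def)
  qed simp
  then show "halts (While index_le_n leaf_body) s
    ((n + 1) * iter_cost index_le_n leaf_body)
    (\<lambda>s. leaf_inv s \<and> nats s ''i'' 0 = Suc n)"
    using s by simp
qed

text \<open>For \<open>S = {1..n}\<close> the clause on \<open>cnt\<close> is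
  \<open>below_children\<close> and the clause on the value is \<open>tree_weight_below\<close>. The
  clause on scanned nodes is vacuous at \<open>v = 1\<close>.\<close>

lemma start_peel_inv:
  assumes "leaf_inv s" "nats s ''i'' 0 = Suc n"
  shows "peel_inv {1..n} (run start_peel s)"
proof -
  have "reals s ''cnt'' v + (\<Sum>z | z \<in> {1..n} \<and> parent z = v. below z) = below v" if "v \<in> {1..n}" for v
    using assms below_children[OF that] that by (simp add: leaf_inv_def)
  moreover have "\<forall>v\<in>{1..n}. parent v \<noteq> 0 \<longrightarrow> parent v \<in> {1..n}"
    using parent_le by (simp add: Suc_le_eq)
  ultimately show ?thesis
    using assms unfolding peel_inv_def leaf_inv_def edges_inv_def pedge_image
    by (simp add: start_peel_def holds_input_def tree_weight_below atLeastLessThanSuc_atLeastAtMost)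
qed

text \<open>Degree one means that \<open>a\<close> is unpeeled and has no unpeeled child, so
  \<open>cnt\<close> at \<open>a\<close> has reached \<open>below a\<close>. Peeling moves this
  amount from the outstanding children's sum of the parent into the parent's \<open>cnt\<close>, and
  one term of the outstanding value into \<open>value\<close>.\<close>

lemma peel_inv_peel:
  assumes inv: "peel_inv S s" and cur: "nats s ''cur'' 0 = a" "1 \<le> a" "nats s ''deg'' a = 1"
  shows "peel_inv (S - {a}) (run peel s)" "a \<in> S" "nats (run peel s) ''v'' 0 = nats s ''v'' 0"
proof -
  have S: "S \<subseteq> {1..n}" and closed: "\<And>v. v \<in> S \<Longrightarrow> parent v \<noteq> 0 \<Longrightarrow> parent v \<in> S"
    and a: "a \<in> {1..n}" and input: "input s"
    and deg: "\<And>v. v \<le> n \<Longrightarrow> nats s ''deg'' v = inc_sum (\<lambda>_. 1) (pedge ` S) v"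
    and esum: "\<And>v. v \<le> n \<Longrightarrow> nats s ''esum'' v = inc_sum id (pedge ` S) v"
    and cnt: "\<And>v. v \<in> {1..n} \<Longrightarrow>
      reals s ''cnt'' v + (\<Sum>z | z \<in> S \<and> parent z = v. below z) = below v"
    and wbar: "\<And>e. e \<in> {1..n} \<Longrightarrow> reals s ''wbar'' e = upgraded e"
    and val: "reals s ''value'' 0 + (\<Sum>v\<in>S. below v * upgraded (pedge v)) = tree_weight n ends upgraded"
    and finished: "\<forall>v\<in>{1..<nats s ''v'' 0}. v \<noteq> nats s ''cur'' 0 \<longrightarrow> nats s ''deg'' v \<noteq> 1"
    and vm: "nats s ''v'' 0 \<in> {1..Suc n}" "nats s ''m'' 0 = card S"
    using inv cur by (auto simp: peel_inv_def)
  have "finite S"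
    using S finite_subset by blast
  have "inc_sum (\<lambda>_. 1) (pedge ` S) a = 1"
    using deg[of a] a cur by simp
  note c = childlessI[OF S closed a this]
  show aS: "a \<in> S"
    by (rule c(1))
  have childless: "\<And>z. z \<in> S \<Longrightarrow> parent z \<noteq> a"
    by (rule c(2))
  have e: "nats s ''esum'' a = pedge a"
    using esum[of a] a inc_sum_childless[OF S aS childless, of id] by simp
  have p: "nats s ''end1'' (pedge a) + nats s ''end2'' (pedge a) - a = parent a"
    using input pedge_in[OF a] ends_pedge[OF a] by (auto simp: holds_input_def)
  have "{z. z \<in> S \<and> parent z = a} = {}"
    using childless by blast
  then have cnt_a: "reals s ''cnt'' a = below a"
    using cnt[OF a] by (simp only: sum.empty add_0_right)
  note par = parent_neq[OF a] parent_le[OF a]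
  have nats':
    "nats (run peel s) ''v'' 0 = nats s ''v'' 0"
    "nats (run peel s) ''cur'' 0 = parent a"
    "nats (run peel s) ''m'' 0 = nats s ''m'' 0 - 1"
    "nats (run peel s) ''deg'' v = nats s ''deg'' v - of_bool (v = a) - of_bool (v = parent a)"
    "nats (run peel s) ''esum'' v =
      nats s ''esum'' v - of_bool (v = a) * pedge a - of_bool (v = parent a) * pedge a" for v
    by (simp_all add: peel_def cur e p)
  have reals':
    "reals (run peel s) ''wbar'' v = reals s ''wbar'' v"
    "reals (run peel s) ''cnt'' v = reals s ''cnt'' v + of_bool (v = parent a) * below a"
    "reals (run peel s) ''value'' 0 = reals s ''value'' 0 + below a * reals s ''wbar'' (pedge a)" for v
    using par by (auto simp: peel_def cur e p cnt_a)
  \<comment> \<open>The truncated subtractions on naturals are exact here, because the subtracted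
    terms are summands of the incidence sum over \<open>S\<close>.\<close>
  have inc: "inc_sum f (pedge ` S) v - of_bool (v = a) * f (pedge a) - of_bool (v = parent a) * f (pedge a) =
      inc_sum f (pedge ` (S - {a})) v" for f v
    unfolding inc_sum_remove[OF S aS] by (simp add: algebra_simps)
  show "nats (run peel s) ''v'' 0 = nats s ''v'' 0"
    by (rule nats')
  show "peel_inv (S - {a}) (run peel s)"
    unfolding peel_inv_def
  proof (intro conjI allI ballI impI)
    show "input (run peel s)"
      using input by (simp add: holds_input_def peel_def)
    show "S - {a} \<subseteq> {1..n}"
      using S by blast
    show "parent v \<in> S - {a}" if "v \<in> S - {a}" "parent v \<noteq> 0" for v
      using that closed childless by blast
    show "nats (run peel s) ''m'' 0 = card (S - {a})"
      using vm aS \<open>finite S\<close> by (simp add: nats')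
    show deg': "nats (run peel s) ''deg'' v = inc_sum (\<lambda>_. 1) (pedge ` (S - {a})) v" if "v \<le> n" for v
      using deg[OF that] inc[of "\<lambda>_. 1" v] by (simp add: nats')
    show "nats (run peel s) ''esum'' v = inc_sum id (pedge ` (S - {a})) v" if "v \<le> n" for v
      using esum[OF that] inc[of id v] by (simp add: nats')
    show "reals (run peel s) ''wbar'' e = upgraded e" if "e \<in> {1..n}" for e
      using wbar[OF that] by (simp add: reals')
    show "reals (run peel s) ''cnt'' v + (\<Sum>z | z \<in> S - {a} \<and> parent z = v. below z) = below v"
      if "v \<in> {1..n}" for v
    proof -
      have "(\<Sum>z | z \<in> S \<and> parent z = v. below z) =
          of_bool (v = parent a) * below a + (\<Sum>z | z \<in> S - {a} \<and> parent z = v. below z)"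
      proof (cases "v = parent a")
        case True
        then have "{z. z \<in> S \<and> parent z = v} = insert a {z. z \<in> S - {a} \<and> parent z = v}"
          using aS by blast
        then show ?thesis
          using True \<open>finite S\<close> by simp
      next
        case False
        then have "{z. z \<in> S \<and> parent z = v} = {z. z \<in> S - {a} \<and> parent z = v}"
          by blast
        then show ?thesis
          using False by simp
      qed
      then show ?thesis
        using cnt[OF that] by (simp add: reals')
    qed
    show "reals (run peel s) ''value'' 0 + (\<Sum>v\<in>S - {a}. below v * upgraded (pedge v)) = tree_weight n ends upgraded"
      using val wbar[OF pedge_in[OF a]] sum.remove[OF \<open>finite S\<close> aS, of "\<lambda>v. below v * upgraded (pedge v)"]
      by (simp add: reals')
    show "nats (run peel s) ''cur'' 0 \<le> n"
      using par by (simp add: nats')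
    show "nats (run peel s) ''v'' 0 \<in> {1..Suc n}"
      using vm by (simp add: nats')
    \<comment> \<open>The degree of \<open>a\<close> has dropped to zero, and of the other nodes
      only the parent, which is the new \<open>cur\<close>, has changed its degree.\<close>
    show "nats (run peel s) ''deg'' v \<noteq> 1"
      if "v \<in> {1..<nats (run peel s) ''v'' 0}" "v \<noteq> nats (run peel s) ''cur'' 0" for v
      using that finished cur by (cases "v = a") (auto simp: nats')
  qed
qed

text \<open>A deepest node of \<open>S\<close> has degree one. Had the scan passed it, the invariant
  would force it to be \<open>cur\<close>, which the failed test excludes; so the scan index is
  still at most \<open>n\<close> while edges remain.\<close>

lemma peel_inv_next_start:
  assumes inv: "peel_inv S s" and "S \<noteq> {}"
    and cur: "\<not> (1 \<le> nats s ''cur'' 0 \<and> nats s ''deg'' (nats s ''cur'' 0) = 1)"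
  shows "peel_inv S (run next_start s)" "nats s ''v'' 0 \<le> n"
    "nats (run next_start s) ''v'' 0 = Suc (nats s ''v'' 0)"
proof -
  have S: "S \<subseteq> {1..n}" and input: "input s"
    and deg: "\<And>v. v \<le> n \<Longrightarrow> nats s ''deg'' v = inc_sum (\<lambda>_. 1) (pedge ` S) v"
    and finished: "\<And>v. 1 \<le> v \<Longrightarrow> v < nats s ''v'' 0 \<Longrightarrow> v \<noteq> nats s ''cur'' 0 \<Longrightarrow> nats s ''deg'' v \<noteq> 1"
    using inv by (auto simp: peel_inv_def)
  obtain v where v: "v \<in> S" "\<And>z. z \<in> S \<Longrightarrow> parent z \<noteq> v"
    using ex_deepest[OF S \<open>S \<noteq> {}\<close>] by blast
  have "v \<in> {1..n}"
    using S v(1) by blast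
  then have "nats s ''deg'' v = 1"
    using deg[of v] inc_sum_childless[OF S v, of "\<lambda>_. 1"] by simp
  then have "\<not> v < nats s ''v'' 0"
    using finished[of v] cur \<open>v \<in> {1..n}\<close> by auto
  then show le: "nats s ''v'' 0 \<le> n"
    using \<open>v \<in> {1..n}\<close> by simp
  show "nats (run next_start s) ''v'' 0 = Suc (nats s ''v'' 0)"
    by (simp add: next_start_def)
  \<comment> \<open>The failed test removes the exception for \<open>cur\<close> from the invariant,
    so \<open>cur\<close> may be overwritten; the new \<open>cur\<close> is the only index added to
    the scanned range.\<close>
  have "nats s ''deg'' v \<noteq> 1" if "1 \<le> v" "v < nats s ''v'' 0" for v
    using finished[OF that] cur that by auto
  then show "peel_inv S (run next_start s)"
    using inv le by (auto simp: peel_inv_def next_start_def holds_input_def less_Suc_eq)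
qed

lemma halts_peel_phase:
  assumes "leaf_inv s" "nats s ''i'' 0 = Suc n"
  shows "halts peel_phase s (peel_time n)
    (\<lambda>s. (\<forall>e\<in>{1..n}. output_vector s e = upgraded e) \<and> output_value s = tree_weight n ends upgraded)"
    (is "halts _ _ _ ?Q")
  unfolding peel_phase_def peel_time_def
proof (rule halts_Seq)
  show "halts start_peel s (cost start_peel)
      (\<lambda>s. peel_inv {1..n} s \<and> nats s ''v'' 0 = 1)"
    using start_peel_inv[OF assms] by (intro halts_straight) (auto simp: start_peel_def)
next
  fix s
  assume s: "peel_inv {1..n} s \<and> nats s ''v'' 0 = 1"
  \<comment> \<open>Remaining edges plus start nodes not yet fetched: peeling lowers the first
    summand, \<open>next_start\<close> the second. Initially both are \<open>n\<close>.\<close>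
  let ?m = "\<lambda>s. nats s ''m'' 0 + (Suc n - nats s ''v'' 0)"
  have "halts (While edges_left peel_body) s (Suc (?m s) * iter_cost edges_left peel_body) ?Q"
  proof (rule halts_While)
    \<comment> \<open>The set of unpeeled nodes is not stored in memory; only its size is, in cell
      \<open>m\<close>. The loop invariant therefore quantifies over it.\<close>
    show "\<exists>S. peel_inv S s"
      using s by blast
    show "(\<exists>S. peel_inv S (run peel_body s)) \<and> ?m (run peel_body s) < ?m s"
      if ex: "\<exists>S. peel_inv S s" and guard: "bval edges_left s" for s
    proof -
      obtain S where S: "peel_inv S s"
        using ex by blast
      then have m: "nats s ''m'' 0 = card S" "S \<noteq> {}" "finite S"
        using guard by (auto simp: peel_inv_def finite_subset)
      let ?a = "nats s ''cur'' 0"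
      show ?thesis
      proof (cases "1 \<le> ?a \<and> nats s ''deg'' ?a = 1")
        case True
        then have run: "run peel_body s = run peel s"
          by (simp add: peel_body_def)
        note P = peel_inv_peel[OF S refl conjunct1[OF True] conjunct2[OF True]]
        have "nats (run peel s) ''m'' 0 = card (S - {?a})"
          using P(1) by (simp add: peel_inv_def)
        also have "\<dots> < card S"
          using P(2) m by (intro psubset_card_mono) auto
        finally show ?thesis
          using P m unfolding run by auto
      next
        case False
        then have run: "run peel_body s = run next_start s"
          by (auto simp: peel_body_def)
        note P = peel_inv_next_start[OF S m(2) False]
        have "nats (run next_start s) ''m'' 0 = card S"
          using P(1) by (simp add: peel_inv_def)
        then show ?thesis
          using P m unfolding run by auto
      qed
    qed
    show "?Q s" if ex: "\<exists>S. peel_inv S s" and guard: "\<not> bval edges_left s" for s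
    proof -
      obtain S where S: "peel_inv S s"
        using ex by blast
      moreover have "finite S" "card S = 0"
        using S guard by (auto simp: peel_inv_def finite_subset)
      then have "S = {}"
        by simp
      ultimately show ?thesis
        by (simp add: peel_inv_def output_vector_def output_value_def)
    qed
  qed simp
  moreover have "nats s ''m'' 0 = n"
    using s by (simp add: peel_inv_def)
  ultimately show "halts (While edges_left peel_body) s
      ((2 * n + 1) * iter_cost edges_left peel_body) ?Q"
    using s by (simp add: mult_2)
qed

lemma halts_subroutine:
  assumes "input s"
  shows "halts subroutine s (time n)
    (\<lambda>s. (\<forall>e\<in>{1..n}. output_vector s e = upgraded e) \<and> output_value s = tree_weight n ends upgraded)"
  unfolding subroutine_def time_def
  by (rule halts_Seq[OF halts_init_phase[OF assms]], erule halts_Seq[OF halts_edge_phase],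
      erule halts_Seq[OF halts_leaf_phase], rule halts_peel_phase) simp_all

end

section \<open>Optimality of the upgraded vector\<close>

lemma feasible_iff:
  assumes "1 \<le> n"
  shows "sdipt_bh_feasible n w u c K y \<longleftrightarrow>
    (\<forall>e\<in>{1..n}. c e * hamming (y e) (w e) \<le> K \<and> w e \<le> y e \<and> y e \<le> u e)"
  \<comment> \<open>\<open>1 <= n\<close> makes the set under \<open>Max\<close> nonempty, so that
    bounding the maximum means bounding every element.\<close>
  using assms by (auto simp: sdipt_bh_feasible_def)

text \<open>An unchanged edge contributes 0 to the maximum, which is where \<open>0 <= K\<close>
  enters. A changed edge contributes its full cost, so edges of cost above \<open>K\<close> keep
  weight \<open>w\<close> in every feasible vector. \<open>y\<close> is fixed on the edges only,
  since the other cells of the output array are arbitrary.\<close>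

lemma (in rooted_tree) upgraded_weight_solution:
  assumes inst: "sdipt_instance n ends w u c" and "0 \<le> K"
    and y: "\<And>e. e \<in> {1..n} \<Longrightarrow> y e = upgraded_weight w u c K e"
  shows "sdipt_bh_solution n ends w u c K y (tree_weight n ends (upgraded_weight w u c K))"
proof -
  have n: "1 \<le> n"
    using inst by (simp add: sdipt_instance_def)
  have "sdipt_bh_feasible n w u c K y"
    using inst \<open>0 \<le> K\<close> y by (auto simp: feasible_iff[OF n] sdipt_instance_def upgraded_weight_def hamming_def)
  moreover have "tree_weight n ends z \<le> tree_weight n ends (upgraded_weight w u c K)"
    if "sdipt_bh_feasible n w u c K z" for z
    using that by (intro tree_weight_mono)
      (force simp: feasible_iff[OF n] upgraded_weight_def hamming_def split: if_splits)
  ultimately show ?thesis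
    using tree_weight_cong[OF y] by (simp add: sdipt_bh_solution_def)
qed

theorem theorem11:
  shows "\<exists>(subroutine :: com) (time :: nat \<Rightarrow> nat).
    (\<lambda>n. real (time n)) \<in> O(\<lambda>n. real n) \<and>
    (\<forall>n ends w u c K s.
      sdipt_instance n ends w u c \<and> holds_input s n ends w u c K \<longrightarrow>
      (\<exists>t s'. exec subroutine s t s' \<and> t \<le> time n \<and>
        (\<forall>e\<in>{1..n}. output_vector s' e = upgraded_weight w u c K e) \<and>
        output_value s' = tree_weight n ends (upgraded_weight w u c K) \<and>
        (0 \<le> K \<longrightarrow>
          sdipt_bh_solution n ends w u c K (output_vector s') (output_value s'))))"
proof (intro exI[of _ subroutine] exI[of _ time] conjI allI impI)
  show "(\<lambda>n. real (time n)) \<in> O(\<lambda>n. real n)"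
    by (rule time_bigo)
  fix n ends w u c K s
  assume *: "sdipt_instance n ends w u c \<and> holds_input s n ends w u c K"
  interpret sdipt_tree n ends w u c K
    using * by unfold_locales (simp add: sdipt_instance_def)
  obtain t s' where "exec subroutine s t s'" "t \<le> time n"
      "\<forall>e\<in>{1..n}. output_vector s' e = upgraded e" "output_value s' = tree_weight n ends upgraded"
    using halts_subroutine * unfolding halts_def by blast
  then show "\<exists>t s'. exec subroutine s t s' \<and> t \<le> time n \<and>
        (\<forall>e\<in>{1..n}. output_vector s' e = upgraded_weight w u c K e) \<and>
        output_value s' = tree_weight n ends (upgraded_weight w u c K) \<and>
        (0 \<le> K \<longrightarrow>
          sdipt_bh_solution n ends w u c K (output_vector s') (output_value s'))"
    using upgraded_weight_solution[of w u c K "output_vector s'"] *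
    by (intro exI[of _ t] exI[of _ s']) simp
qed

end
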